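(* Let $k\ge 3$ and $n\ge 1$ be integers, and let $\mathcal{H}(n,k)$ be the hierarchical graph, with $N_n=k^n$ vertices. The first-order network coherence of $\mathcal{H}(n,k)$ is $$H_1(\mathcal{H}(n,k))=\frac{(2n-1)k^n-2nk^{n-1}+1}{2k^{n+1}}.$$ Moreover, for fixed $k$, as $n\to\infty$, $$H_1(\mathcal{H}(n,k))\sim \frac{k-1}{k^2}\log_k N_n,$$ i.e. the ratio of the two sides tends to $1$.
   Context: Hierarchical graphs: for $k\ge 3$, $\mathcal{H}(1,k)$ is the complete graph $\mathcal{K}_k$ on $k$ vertices. For $n>1$, $\mathcal{H}(n,k)$ is obtained from $\mathcal{H}(n-1,k)$ as follows: for each vertex $v$ of $\mathcal{H}(n-1,k)$, create a new complete graph $\mathcal{K}_{k-1}$ (on $k-1$ new vertices) and join all its $k-1$ vertices to $v$. First-order network coherence: let $\mathcal{G}$ be a connected undirected graph with $N$ vertices and Laplacian matrix $\mathbf{L}=\mathbf{D}-\mathbf{A}$ (degree matrix minus adjacency matrix), with eigenvalues $0=\lambda_1<\lambda_2\le\cdots\le\lambda_N$. Consider the noisy consensus dynamics $\dot x(t)=-\mathbf{L}x(t)+w(t)$, where $w(t)\in\mathbb{R}^N$ is zero-mean, unit-variance white noise with independent components, and $\sum_i x_i(0)=0$. The first-order network coherence $H_1(\mathcal{G})$ is the mean steady-state variance of the deviation from the average, $H_1(\mathcal{G})=\frac1N\sum_{i=1}^N\lim_{t\to\infty}\mathbf{E}\big\{\big(x_i(t)-\frac1N\sum_{j=1}^N x_j(t)\big)^2\big\}$.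 It is a known fact, which may be taken as the definition of $H_1$, that $H_1(\mathcal{G})=\frac{1}{2N}\sum_{i=2}^{N}\frac{1}{\lambda_i}$. *)

theory Defs
  imports
    "HOL-Analysis.Analysis"
    "Graph_Theory.Pair_Digraph"
    "Graph_Theory.Digraph_Component"
    "Jordan_Normal_Form.Char_Poly"
begin

section \<open>Hierarchical graphs\<close>

text \<open>
  An undirected simple graph is a symmetric loop-free digraph: each edge is represented by its
  two arcs (see the locale \<open>pair_graph\<close>).
\<close>

definition complete_arcs :: "'a set \<Rightarrow> ('a \<times> 'a) set" where
  "complete_arcs S = {(u, v). u \<in> S \<and> v \<in> S \<and> u \<noteq> v}"

definition complete_graph :: "nat \<Rightarrow> nat pair_pre_digraph" where
  "complete_graph k = \<lparr> pverts = {..<k}, parcs = complete_arcs {..<k} \<rparr>"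

text \<open>
  For a graph with vertex set \<open>{..<N}\<close>, the numbers \<open>v + c * N\<close> with \<open>1 \<le> c < k\<close> serve as the
  \<open>k - 1\<close> new vertices created for \<open>v\<close>. They are not below \<open>N\<close>, and the sets belonging to
  different \<open>v < N\<close> are disjoint.
\<close>

definition new_vertices :: "nat \<Rightarrow> nat \<Rightarrow> nat \<Rightarrow> nat set" where
  "new_vertices k N v = {v + c * N | c. 1 \<le> c \<and> c < k}"

definition attach_cliques :: "nat \<Rightarrow> nat pair_pre_digraph \<Rightarrow> nat pair_pre_digraph" where
  "attach_cliques k G = (let new = new_vertices k (card (pverts G)) in
     \<lparr> pverts = pverts G \<union> (\<Union>v\<in>pverts G. new v),
       parcs = parcs G \<union>
         (\<Union>v\<in>pverts G. complete_arcs (new v) \<union> {v} \<times> new v \<union> new v \<times> {v}) \<rparr>)"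

text \<open>Only the values for \<open>n \<ge> 1\<close> are meaningful.\<close>

definition hierarchical_graph :: "nat \<Rightarrow> nat \<Rightarrow> nat pair_pre_digraph" where
  "hierarchical_graph n k = (attach_cliques k ^^ (n - 1)) (complete_graph k)"


section \<open>First-order network coherence\<close>

text \<open>
  Rows and columns of the matrices are numbered by the vertices in increasing order. For a
  symmetric digraph, the out-degree is the degree of the underlying undirected graph.
\<close>

definition vertex_list :: "'a::linorder pair_pre_digraph \<Rightarrow> 'a list" where
  "vertex_list G = sorted_list_of_set (pverts G)"

definition adjacency_matrix :: "'a::linorder pair_pre_digraph \<Rightarrow> real mat" where
  "adjacency_matrix G = mat (card (pverts G)) (card (pverts G))
     (\<lambda>(i, j). if (vertex_list G ! i, vertex_list G ! j) \<in> parcs G then 1 else 0)"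

definition degree_matrix :: "'a::linorder pair_pre_digraph \<Rightarrow> real mat" where
  "degree_matrix G = mat (card (pverts G)) (card (pverts G))
     (\<lambda>(i, j). if i = j then real (out_degree (with_proj G) (vertex_list G ! i)) else 0)"

definition laplacian :: "'a::linorder pair_pre_digraph \<Rightarrow> real mat" where
  "laplacian G = degree_matrix G - adjacency_matrix G"

text \<open>
  The Laplacian of an undirected graph is a real symmetric matrix, so all \<open>N\<close> roots of its
  characteristic polynomial are real; they are listed in increasing order, with multiplicity.
\<close>

definition laplacian_eigenvalues :: "'a::linorder pair_pre_digraph \<Rightarrow> real list" where
  "laplacian_eigenvalues G = sorted_list_of_multiset (proots (char_poly (laplacian G)))"

text \<open>
  The mean steady-state variance of the deviation from the average in the noisy consensus dynamics
  \<open>x' = - L x + w\<close> equals \<open>1 / (2 N) * (\<Sum>i = 2..N. 1 / \<lambda>\<^sub>i)\<close>; this known formula is taken as the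
  definition. Here \<open>\<lambda>\<^sub>i\<close> is entry number \<open>i - 1\<close> of the list, so the sum below ranges over \<open>\<lambda>\<^sub>2, \<dots>, \<lambda>\<^sub>N\<close>. The definition
  is meant for connected undirected graphs, for which \<open>0 = \<lambda>\<^sub>1 < \<lambda>\<^sub>2\<close>.
\<close>

definition network_coherence1 :: "'a::linorder pair_pre_digraph \<Rightarrow> real" where
  "network_coherence1 G = 1 / (2 * real (card (pverts G))) *
     (\<Sum>i = 1..<card (pverts G). 1 / (laplacian_eigenvalues G ! i))"


section \<open>Hierarchical graphs are connected undirected graphs\<close>

lemma hierarchical_graph_1: "hierarchical_graph 1 k = complete_graph k"
  by (simp add: hierarchical_graph_def)

lemma hierarchical_graph_Suc:
  assumes "n \<ge> 1"
  shows "hierarchical_graph (Suc n) k = attach_cliques k (hierarchical_graph n k)"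
proof -
  obtain m where "n = Suc m" using assms by (cases n) auto
  then show ?thesis by (simp add: hierarchical_graph_def)
qed

lemma pverts_attach_cliques:
  assumes "pverts G = {..<N}" "k \<ge> 1" "N \<ge> 1"
  shows "pverts (attach_cliques k G) = {..<k * N}"
proof -
  have "x \<in> {..<N} \<union> (\<Union>v<N. new_vertices k N v) \<longleftrightarrow> x < k * N" for x
  proof
    assume "x \<in> {..<N} \<union> (\<Union>v<N. new_vertices k N v)"
    then obtain v c where vc: "x = v + c * N" "v < N" "c < k"
      using assms(2) by (force simp: new_vertices_def)
    then have "x < Suc c * N" by simp
    also have "\<dots> \<le> k * N" using vc(3) by (intro mult_right_mono) auto
    finally show "x < k * N" .
  next
    assume x: "x < k * N"
    then have c: "x div N < k" by (simp add: less_mult_imp_div_less)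
    have v: "x mod N < N" using assms(3) by simp
    have "x = x mod N + x div N * N" by simp
    then have "x \<in> new_vertices k N (x mod N)" if "x \<ge> N"
      using c that assms(3) unfolding new_vertices_def
      by (auto simp: Suc_le_eq div_greater_zero_iff intro!: exI[of _ "x div N"])
    then show "x \<in> {..<N} \<union> (\<Union>v<N. new_vertices k N v)"
      using v by (cases "x < N") auto
  qed
  then show ?thesis
    by (auto simp: attach_cliques_def Let_def assms(1))
qed

lemma pverts_hierarchical_graph:
  assumes "k \<ge> 1" "n \<ge> 1"
  shows "pverts (hierarchical_graph n k) = {..<k ^ n}"
  using assms(2)
proof (induction n rule: dec_induct)
  case base
  show ?case by (simp add: hierarchical_graph_1 complete_graph_def del: One_nat_def)
next
  case (step n)
  have "k ^ n \<ge> 1" using assms(1) by simp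
  from pverts_attach_cliques[OF step.IH assms(1) this] step.hyps show ?case
    by (simp add: hierarchical_graph_Suc)
qed

lemma pair_graph_hierarchical_graph:
  assumes "k \<ge> 1" "n \<ge> 1"
  shows "pair_graph (hierarchical_graph n k)"
proof -
  have *: "parcs (hierarchical_graph n k) \<subseteq>
              pverts (hierarchical_graph n k) \<times> pverts (hierarchical_graph n k) \<and>
           sym (parcs (hierarchical_graph n k)) \<and> irrefl (parcs (hierarchical_graph n k))"
    using assms(2)
  proof (induction n rule: dec_induct)
    case base
    show ?case
      by (auto simp: hierarchical_graph_1 complete_graph_def complete_arcs_def sym_def irrefl_def
          simp del: One_nat_def)
  next
    case (step n)
    define G where "G = hierarchical_graph n k"
    have G: "parcs G \<subseteq> pverts G \<times> pverts G" "sym (parcs G)" "irrefl (parcs G)"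
      using step.IH by (auto simp: G_def)
    have N: "card (pverts G) = k ^ n" "k ^ n > 0"
      using assms(1) step.hyps by (auto simp: G_def pverts_hierarchical_graph)
    have nin: "v \<notin> new_vertices k (k ^ n) v" for v
      using N by (auto simp: new_vertices_def)
    show ?case
      using G nin step.hyps
      by (auto simp: hierarchical_graph_Suc G_def[symmetric] attach_cliques_def Let_def N
            complete_arcs_def sym_def irrefl_def)
  qed
  have fin: "finite (pverts (hierarchical_graph n k))"
    using assms by (simp add: pverts_hierarchical_graph)
  show ?thesis
    using * fin by unfold_locales
      (auto simp: sym_def irrefl_def symmetric_def intro: finite_subset)
qed

lemma connected_hierarchical_graph:
  assumes "k \<ge> 1" "n \<ge> 1"
  shows "Digraph_Component.connected (with_proj (hierarchical_graph n k))"
proof -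
  let ?H = "\<lambda>n. hierarchical_graph n k"
  have sym: "sym (parcs (?H n))" if "n \<ge> 1" for n
  proof -
    interpret pair_graph "?H n" using pair_graph_hierarchical_graph assms(1) that .
    show ?thesis using arcs_symmetric by (auto simp: sym_def)
  qed
  have reach: "\<forall>u\<in>pverts (?H n). (0, u) \<in> (parcs (?H n))\<^sup>*"
    using assms(2)
  proof (induction n rule: dec_induct)
    case base
    have "(0, u) \<in> (parcs (complete_graph k))\<^sup>*" if "u < k" for u
      using that by (cases "u = 0") (auto simp: complete_graph_def complete_arcs_def intro!: r_into_rtrancl)
    then show ?case
      unfolding hierarchical_graph_1 by (simp add: complete_graph_def)
  next
    case (step n)
    define G where "G = ?H n"
    have H: "?H (Suc n) = attach_cliques k G" using step.hyps by (simp add: G_def hierarchical_graph_Suc)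
    have sub: "(parcs G)\<^sup>* \<subseteq> (parcs (attach_cliques k G))\<^sup>*"
      by (rule rtrancl_mono) (auto simp: attach_cliques_def Let_def)
    have old: "(0, u) \<in> (parcs (attach_cliques k G))\<^sup>*" if "u \<in> pverts G" for u
      using step.IH that sub by (auto simp: G_def)
    have new: "(0, u) \<in> (parcs (attach_cliques k G))\<^sup>*"
      if "v \<in> pverts G" "u \<in> new_vertices k (card (pverts G)) v" for u v
    proof -
      have "(v, u) \<in> parcs (attach_cliques k G)"
        using that by (auto simp: attach_cliques_def Let_def)
      with old[OF that(1)] show ?thesis by (rule rtrancl_into_rtrancl)
    qed
    show ?case unfolding H
      using old new by (auto simp: attach_cliques_def Let_def)
  qed
  interpret pair_graph "?H n" using pair_graph_hierarchical_graph assms .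
  show ?thesis
    unfolding connected_conv
  proof (intro conjI ballI)
    show "verts (with_proj (?H n)) \<noteq> {}"
      using assms by (simp add: pverts_hierarchical_graph lessThan_empty_iff)
    fix u v assume uv: "u \<in> verts (with_proj (?H n))" "v \<in> verts (with_proj (?H n))"
    have "(u, 0) \<in> (parcs (?H n))\<^sup>*"
      using reach uv sym[OF assms(2)] by (simp add: sym_rtrancl symD)
    with reach uv have "(u, v) \<in> (parcs (?H n))\<^sup>*" by (auto intro: rtrancl_trans)
    then have "(u, v) \<in> rtrancl_on (pverts (?H n)) (parcs (?H n))"
      by (rule rtrancl_consistent_rtrancl_on) (use uv in \<open>auto dest: in_arcsD2\<close>)
    then show "(u, v) \<in> rtrancl_on (verts (with_proj (?H n))) ((arcs_ends (with_proj (?H n)))\<^sup>s)"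
      by (rule rtrancl_on_mono[rotated 2]) (auto simp: symcl_def)
  qed
qed

end

theory Submission
  imports Defs
begin

text \<open>
  With the vertex \<open>v + c * N\<close> read as the pair \<open>(c, v)\<close>, the Laplacian of the graph obtained by attaching
  cliques to a graph with Laplacian \<open>L\<close> is \<open>(k I - J) \<otimes> I + E\<^sub>0\<^sub>0 \<otimes> L\<close>. On vectors whose new blocks sum
  to zero and whose old block vanishes it acts as \<open>k\<close>; on vectors that are constant on each attached
  clique it reduces to a \<open>2 \<times> 2\<close> block, so each eigenvalue \<open>a\<close> of \<open>L\<close> gives the two roots of
  \<open>x\<^sup>2 - (k + a) x + a\<close>. For \<open>a = 0\<close> these are \<open>0\<close> and \<open>k\<close>; for \<open>a > 0\<close> their reciprocals add up to
  \<open>1 + k / a\<close>. This gives a linear recurrence for the sum of the reciprocals of the nonzero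
  eigenvalues. Since attaching a clique to a single vertex yields the complete graph, the recurrence can
  be started at the one-vertex graph.
\<close>


section \<open>Block matrices\<close>

text \<open>The arguments of \<open>f\<close> are row block, row position, column block, column
  position. The layout matches the numbering \<open>v + c * N\<close> of the new vertices, so
  Kronecker products need no nested blocks.\<close>

definition block_mat :: "nat \<Rightarrow> nat \<Rightarrow> (nat \<Rightarrow> nat \<Rightarrow> nat \<Rightarrow> nat \<Rightarrow> 'a) \<Rightarrow> 'a mat" where
  "block_mat k N f =
     mat (k * N) (k * N) (\<lambda>(i, j). f (i div N) (i mod N) (j div N) (j mod N))"

lemma block_mat_carrier [simp]: "block_mat k N f \<in> carrier_mat (k * N) (k * N)"
  by (simp add: block_mat_def)

lemma index_block_mat [simp]:
  "i < k * N \<Longrightarrow> j < k * N \<Longrightarrow>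
     block_mat k N f $$ (i, j) = f (i div N) (i mod N) (j div N) (j mod N)"
  by (simp add: block_mat_def)

lemma dim_block_mat [simp]:
  "dim_row (block_mat k N f) = k * N" "dim_col (block_mat k N f) = k * N"
  by (simp_all add: block_mat_def)

lemma sum_div_mod:
  fixes f :: "nat \<Rightarrow> nat \<Rightarrow> 'a::comm_monoid_add"
  shows "(\<Sum>i<k * N. f (i div N) (i mod N)) = (\<Sum>c<k. \<Sum>v<N. f c v)"
proof -
  have "(\<Sum>i\<in>{c * N..<c * N + N}. f (i div N) (i mod N)) = (\<Sum>v<N. f c v)" for c
  proof -
    have "(\<Sum>i\<in>{c * N..<c * N + N}. f (i div N) (i mod N)) =
          (\<Sum>v\<in>{0..<N}. f ((v + c * N) div N) ((v + c * N) mod N))"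
      using sum.shift_bounds_nat_ivl[of "\<lambda>i. f (i div N) (i mod N)" 0 "c * N" N]
      by (simp add: add.commute)
    also have "\<dots> = (\<Sum>v<N. f c v)"
      by (rule sum.cong) auto
    finally show ?thesis .
  qed
  then show ?thesis
    by (simp flip: sum.nat_group)
qed

lemma block_mat_cong:
  assumes "\<And>c v d w. c < k \<Longrightarrow> v < N \<Longrightarrow> d < k \<Longrightarrow> w < N \<Longrightarrow> f c v d w = g c v d w"
  shows "block_mat k N f = block_mat k N g"
proof (rule eq_matI)
  fix i j assume "i < dim_row (block_mat k N g)" "j < dim_col (block_mat k N g)"
  then have ij: "i < k * N" "j < k * N" by auto
  then have "N > 0" by (cases N) auto
  then show "block_mat k N f $$ (i, j) = block_mat k N g $$ (i, j)"
    using ij assms by (simp add: less_mult_imp_div_less)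
qed auto

text \<open>Allows a matrix identity such as \<open>A * T = T * B\<close> to be checked one block
  entry at a time.\<close>

lemma block_mat_mult:
  fixes f g :: "nat \<Rightarrow> nat \<Rightarrow> nat \<Rightarrow> nat \<Rightarrow> 'a::semiring_0"
  shows "block_mat k N f * block_mat k N g =
         block_mat k N (\<lambda>c v d w. \<Sum>e<k. \<Sum>u<N. f c v e u * g e u d w)"
proof (rule eq_matI)
  fix i j
  assume "i < dim_row (block_mat k N (\<lambda>c v d w. \<Sum>e<k. \<Sum>u<N. f c v e u * g e u d w))"
    "j < dim_col (block_mat k N (\<lambda>c v d w. \<Sum>e<k. \<Sum>u<N. f c v e u * g e u d w))"
  then have ij: "i < k * N" "j < k * N" by auto
  have "(block_mat k N f * block_mat k N g) $$ (i, j) =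
        (\<Sum>l<k * N. f (i div N) (i mod N) (l div N) (l mod N) *
                   g (l div N) (l mod N) (j div N) (j mod N))"
    using ij by (simp add: scalar_prod_def lessThan_atLeast0)
  also have "\<dots> = block_mat k N (\<lambda>c v d w. \<Sum>e<k. \<Sum>u<N. f c v e u * g e u d w) $$ (i, j)"
    using ij sum_div_mod[of "\<lambda>c v. f (i div N) (i mod N) c v * g c v (j div N) (j mod N)"]
    by simp
  finally show "(block_mat k N f * block_mat k N g) $$ (i, j) =
    block_mat k N (\<lambda>c v d w. \<Sum>e<k. \<Sum>u<N. f c v e u * g e u d w) $$ (i, j)" .
qed auto

lemma less_two_mult_cases:
  fixes i N :: nat
  assumes "i < 2 * N"
  obtains "i < N" "i div N = 0" "i mod N = i"
  | "N \<le> i" "i - N < N" "i div N = 1" "i mod N = i - N"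
proof (cases "i < N")
  case False
  then have i: "N \<le> i" "i - N < N" "N > 0" using assms by auto
  then have "i div N = 1" "i mod N = i - N"
    by (simp_all add: le_div_geq le_mod_geq)
  then show ?thesis using that(2) i by simp
qed (use that(1) in simp)


section \<open>The Laplacian of a graph with cliques attached\<close>

text \<open>The matrix \<open>(k I - J) \<otimes> I\<^sub>N + E\<^sub>0\<^sub>0 \<otimes> L\<close>, where \<open>J\<close> is the all-ones matrix of size \<open>k\<close>.\<close>

definition attach_mat :: "nat \<Rightarrow> nat \<Rightarrow> real mat \<Rightarrow> real mat" where
  "attach_mat k N L = block_mat k N (\<lambda>c v d w.
     of_bool (v = w) * (real k * of_bool (c = d) - 1) + of_bool (c = 0 \<and> d = 0) * L $$ (v, w))"

lemma attach_mat_carrier [simp]: "attach_mat k N L \<in> carrier_mat (k * N) (k * N)"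
  by (simp add: attach_mat_def)

text \<open>Evaluation at a number \<open>x\<close> keeps all determinants over the reals. A change
  of basis turns \<open>x I - attach_mat k N L\<close> into a block triangular matrix: a corner of
  size \<open>2 * N\<close> on the old block and the sum of the new blocks, and the scalar
  \<open>x - k\<close> on the remaining \<open>(k - 2) * N\<close> dimensions.\<close>

lemma poly_char_poly_attach_mat:
  fixes L :: "real mat"
  assumes L: "L \<in> carrier_mat N N" and k: "k \<ge> 2"
  shows "poly (char_poly (attach_mat k N L)) x =
         (x - real k) ^ ((k - 2) * N) * det ((x * (x - real k)) \<cdot>\<^sub>m 1\<^sub>m N - (x - 1) \<cdot>\<^sub>m L)"
proof (cases "N = 0")
  case True
  then have "attach_mat k N L \<in> carrier_mat 0 0"
    using attach_mat_carrier[of k N L] by simp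
  then show ?thesis using True L
    by (simp add: char_poly_def char_poly_matrix_def det_def)
next
  case False
  define r where "r = real k"
  define a where "a = (\<lambda>c v d w. of_bool (v = w) * (of_bool (c = d) * (x - r) + 1)
                        - of_bool (c = 0 \<and> d = (0::nat)) * L $$ (v, w))"
  define t where "t = (\<lambda>c v d w. of_bool (v = (w::nat)) *
                        (of_bool (c = d) + of_bool (d = Suc 0 \<and> c \<ge> 2) :: real))"
  \<comment> \<open>The columns of \<open>b\<close> are the images of the new basis under
    \<open>A\<close>. Let \<open>e_c\<close> be the blocks and \<open>f\<close> the sum of those
    with \<open>c >= 1\<close>. Then \<open>e_0\<close> goes to
    \<open>(x - r + 1 - L) e_0 + f\<close>, \<open>f\<close> to
    \<open>(r - 1) e_0 + (x - 1) f\<close>, and \<open>e_d\<close> with \<open>d >= 2\<close> to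
    \<open>e_0 + f + (x - r) e_d\<close>.\<close>
  define b where "b = (\<lambda>c v d w.
       if c = (0::nat) then (if d = (0::nat) then of_bool (v = w) * (x - r + 1) - L $$ (v, w)
                      else if d = 1 then of_bool (v = w) * (r - 1) else of_bool (v = w))
       else if c = 1 then of_bool (v = w) * (if d = 1 then x - 1 else 1)
       else of_bool (v = w) * (of_bool (c = d) * (x - r)))"
  define A T B where "A = block_mat k N a" and "T = block_mat k N t" and "B = block_mat k N b"
  have carr: "A \<in> carrier_mat (k * N) (k * N)" "T \<in> carrier_mat (k * N) (k * N)"
    "B \<in> carrier_mat (k * N) (k * N)"
    by (simp_all add: A_def T_def B_def)

  \<comment> \<open>\<open>T\<close> replaces the basis vector of block 1 by the sum of those of the blocks \<open>c \<ge> 1\<close>; in the new basis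
    the matrix is block triangular.\<close>
  have "A * T = T * B"
    unfolding A_def T_def B_def block_mat_mult
  proof (rule block_mat_cong)
    fix c v d w assume lt: "c < k" "v < N" "d < k" "w < N"
    have "(\<Sum>e<k. \<Sum>u<N. a c v e u * t e u d w) =
          (\<Sum>e<k. a c v e w * (of_bool (e = d) + of_bool (d = Suc 0 \<and> e \<ge> 2)))"
    proof (rule sum.cong)
      fix e assume "e \<in> {..<k}"
      have "(\<Sum>u<N. a c v e u * t e u d w) = (\<Sum>u<N. if u = w then
              a c v e w * (of_bool (e = d) + of_bool (d = Suc 0 \<and> e \<ge> 2)) else 0)"
        by (rule sum.cong) (auto simp: t_def)
      then show "(\<Sum>u<N. a c v e u * t e u d w) =
          a c v e w * (of_bool (e = d) + of_bool (d = Suc 0 \<and> e \<ge> 2))"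
        using lt by simp
    qed simp
    \<comment> \<open>Only column block 1 of \<open>T\<close> has entries off the diagonal; there
      the blocks \<open>e >= 2\<close> are added.\<close>
    also have "\<dots> = (\<Sum>e<k. if e = d then a c v e w else 0) +
                    (\<Sum>e<k. if d = 1 \<and> e \<ge> 2 then a c v e w else 0)"
      unfolding sum.distrib[symmetric] by (rule sum.cong) (auto simp: algebra_simps)
    also have "(\<Sum>e<k. if e = d then a c v e w else 0) = a c v d w"
      using lt by simp
    also have "(\<Sum>e<k. if d = 1 \<and> e \<ge> 2 then a c v e w else 0) =
               of_bool (d = 1) * (\<Sum>e\<in>{2..<k}. a c v e w)"
    proof -
      have "(\<Sum>e\<in>{2..<k}. a c v e w) = (\<Sum>e<k. if e \<ge> 2 then a c v e w else 0)"
        by (rule sum.mono_neutral_cong_left) auto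
      then show ?thesis by auto
    qed
    also have "(\<Sum>e\<in>{2..<k}. a c v e w) =
               of_bool (v = w) * (of_bool (c \<ge> 2) * (x - r) + (r - 2))"
    proof -
      have "(\<Sum>e\<in>{2..<k}. a c v e w) =
            (\<Sum>e\<in>{2..<k}. of_bool (v = w) * ((if c = e then x - r else 0) + 1))"
        by (rule sum.cong) (auto simp: a_def)
      also have "\<dots> = of_bool (v = w) * (of_bool (c \<ge> 2) * (x - r) + (r - 2))"
        using lt k by (simp add: sum.distrib r_def of_nat_diff flip: sum_distrib_left)
      finally show ?thesis .
    qed
    finally have lhs: "(\<Sum>e<k. \<Sum>u<N. a c v e u * t e u d w) = a c v d w +
       of_bool (d = 1) * (of_bool (v = w) * (of_bool (c \<ge> 2) * (x - r) + (r - 2)))" .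
    have "(\<Sum>e<k. \<Sum>u<N. t c v e u * b e u d w) =
          (\<Sum>e<k. (of_bool (c = e) + of_bool (e = Suc 0 \<and> c \<ge> 2)) * b e v d w)"
    proof (rule sum.cong)
      fix e assume "e \<in> {..<k}"
      have "(\<Sum>u<N. t c v e u * b e u d w) = (\<Sum>u<N. if u = v then
              (of_bool (c = e) + of_bool (e = Suc 0 \<and> c \<ge> 2)) * b e v d w else 0)"
        by (rule sum.cong) (auto simp: t_def)
      then show "(\<Sum>u<N. t c v e u * b e u d w) =
          (of_bool (c = e) + of_bool (e = Suc 0 \<and> c \<ge> 2)) * b e v d w"
        using lt by simp
    qed simp
    also have "\<dots> = (\<Sum>e<k. if e = c then b e v d w else 0) +
                    (\<Sum>e<k. if e = Suc 0 then of_bool (c \<ge> 2) * b e v d w else 0)"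
      unfolding sum.distrib[symmetric] by (rule sum.cong) (auto simp: algebra_simps)
    also have "\<dots> = b c v d w + of_bool (c \<ge> 2) * b 1 v d w"
      using lt k by simp
    finally have rhs: "(\<Sum>e<k. \<Sum>u<N. t c v e u * b e u d w) =
        b c v d w + of_bool (c \<ge> 2) * b 1 v d w" .
    show "(\<Sum>e<k. \<Sum>u<N. a c v e u * t e u d w) = (\<Sum>e<k. \<Sum>u<N. t c v e u * b e u d w)"
      unfolding lhs rhs by (auto simp: a_def b_def not_le less_2_cases_iff)
  qed

  \<comment> \<open>The extra entries of \<open>T\<close> lie in rows of block \<open>>= 2\<close>
    and columns of block 1, hence below the unit diagonal.\<close>
  moreover have "det T = 1"
  proof -
    have "det T = prod_list (diag_mat T)"
    proof (rule det_lower_triangular[OF _ carr(2)])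
      fix i j assume ij: "i < j" "j < k * N"
      have "\<not> (i mod N = j mod N \<and> i div N = j div N)"
        using ij(1) by (metis div_mult_mod_eq less_irrefl)
      moreover have "i div N \<le> j div N" using ij(1) by (simp add: div_le_mono)
      ultimately show "T $$ (i, j) = 0"
        using ij by (auto simp: T_def t_def)
    qed
    also have "diag_mat T = replicate (k * N) 1"
      by (rule nth_equalityI) (auto simp: diag_mat_def T_def t_def)
    finally show ?thesis by simp
  qed

  ultimately have "det A = det B"
    using det_mult[OF carr(1,2)] det_mult[OF carr(2,3)] by simp

  \<comment> \<open>\<open>P\<close> is the corner belonging to \<open>e_0\<close> and
    \<open>f\<close>; \<open>Q\<close> stands above the scalar block and drops out of the
    determinant.\<close>
  define P where "P = four_block_mat ((x - r + 1) \<cdot>\<^sub>m 1\<^sub>m N - L) ((r - 1) \<cdot>\<^sub>m 1\<^sub>m N)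
                        (1\<^sub>m N) ((x - 1) \<cdot>\<^sub>m 1\<^sub>m N)"
  define Q where "Q = mat (2 * N) ((k - 2) * N) (\<lambda>(i, j). B $$ (i, j + 2 * N))"
  have P: "P \<in> carrier_mat (2 * N) (2 * N)" unfolding P_def mult_2 by (rule four_block_carrier_mat) (use L in auto)
  have kN: "2 * N + (k - 2) * N = k * N"
    using k by (metis add_mult_distrib le_add_diff_inverse)
  have "B = four_block_mat P Q (0\<^sub>m ((k - 2) * N) (2 * N)) ((x - r) \<cdot>\<^sub>m 1\<^sub>m ((k - 2) * N))"
    (is "_ = ?F")
  proof (rule eq_matI)
    have dF: "dim_row ?F = k * N" "dim_col ?F = k * N"
      using P kN by auto
    then show "dim_row B = dim_row ?F" "dim_col B = dim_col ?F"
      by (simp_all add: B_def)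
    fix i j assume "i < dim_row ?F" "j < dim_col ?F"
    then have ij: "i < k * N" "j < k * N" by (simp_all only: dF)
    have Bij: "B $$ (i, j) = b (i div N) (i mod N) (j div N) (j mod N)"
      using ij by (simp add: B_def)
    have ge: "l div N \<ge> 2" if "\<not> l < 2 * N" for l
      using that False by (simp add: less_eq_div_iff_mult_less_eq)
    have Fij: "?F $$ (i, j) =
       (if i < 2 * N then if j < 2 * N then P $$ (i, j) else B $$ (i, j)
        else if j < 2 * N then 0 else if i = j then x - r else 0)"
      using ij P kN by (subst index_mat_four_block(1)) (auto simp: Q_def)
    show "B $$ (i, j) = ?F $$ (i, j)"
    proof (cases "i < 2 * N")
      case i: True
      show ?thesis
      proof (cases "j < 2 * N")
        case j: True
        have "P $$ (i, j) = b (i div N) (i mod N) (j div N) (j mod N)"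
          using i
        proof (cases rule: less_two_mult_cases)
          case 1
          with j L show ?thesis
            by (cases rule: less_two_mult_cases) (auto simp: P_def b_def)
        next
          case 2
          with j L show ?thesis
            by (cases rule: less_two_mult_cases) (auto simp: P_def b_def)
        qed
        then show ?thesis using Fij Bij i j by simp
      qed (use Fij i in simp)
    next
      case i: False
      have eq: "i mod N = j mod N \<and> i div N = j div N \<longleftrightarrow> i = j"
        by (metis div_mult_mod_eq)
      have "b (i div N) (i mod N) (j div N) (j mod N) = (if i = j then x - r else 0)"
        using ge[OF i] eq by (auto simp: b_def)
      then show ?thesis using Fij Bij i by auto
    qed
  qed
  then have "det B = det P * det ((x - r) \<cdot>\<^sub>m 1\<^sub>m ((k - 2) * N))"
    using det_four_block_mat_lower_left_zero[OF P, of Q "(k - 2) * N"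
        "0\<^sub>m ((k - 2) * N) (2 * N)" "(x - r) \<cdot>\<^sub>m 1\<^sub>m ((k - 2) * N)"]
    by (simp add: Q_def)
  \<comment> \<open>The lower blocks of \<open>P\<close> are multiples of the identity and so
    commute, which permits expanding the determinant as for a 2 by 2 matrix.\<close>
  also have "det P = det (((x - r + 1) \<cdot>\<^sub>m 1\<^sub>m N - L) * ((x - 1) \<cdot>\<^sub>m 1\<^sub>m N)
                          - ((r - 1) \<cdot>\<^sub>m 1\<^sub>m N) * 1\<^sub>m N)"
    unfolding P_def by (rule det_four_block_mat) (use L in auto)
  also have "((x - r + 1) \<cdot>\<^sub>m 1\<^sub>m N - L) * ((x - 1) \<cdot>\<^sub>m 1\<^sub>m N) - ((r - 1) \<cdot>\<^sub>m 1\<^sub>m N) * 1\<^sub>m N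
             = (x * (x - r)) \<cdot>\<^sub>m 1\<^sub>m N - (x - 1) \<cdot>\<^sub>m L"
  proof -
    have "((x - r + 1) \<cdot>\<^sub>m 1\<^sub>m N - L) * ((x - 1) \<cdot>\<^sub>m 1\<^sub>m N) =
          (x - 1) \<cdot>\<^sub>m ((x - r + 1) \<cdot>\<^sub>m 1\<^sub>m N - L)"
      using L by (subst mult_smult_distrib[of _ N N]) auto
    then show ?thesis using L
      by (intro eq_matI) (auto simp: algebra_simps)
  qed
  finally have detB: "det B = (x - r) ^ ((k - 2) * N) *
      det ((x * (x - r)) \<cdot>\<^sub>m 1\<^sub>m N - (x - 1) \<cdot>\<^sub>m L)"
    by (simp add: mult.commute)

  have "A = - char_matrix (attach_mat k N L) x"
  proof (rule eq_matI)
    fix i j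
    assume "i < dim_row (- char_matrix (attach_mat k N L) x)"
      "j < dim_col (- char_matrix (attach_mat k N L) x)"
    then have ij: "i < k * N" "j < k * N"
      by (simp_all add: char_matrix_def attach_mat_def)
    have eq: "i = j \<longleftrightarrow> i mod N = j mod N \<and> i div N = j div N"
      by (metis div_mult_mod_eq)
    show "A $$ (i, j) = (- char_matrix (attach_mat k N L) x) $$ (i, j)"
      using ij by (auto simp: char_matrix_def attach_mat_def A_def a_def r_def eq)
  qed (simp_all add: char_matrix_def attach_mat_def A_def)
  then show ?thesis
    using char_poly_matrix[OF attach_mat_carrier] \<open>det A = det B\<close> detB
    by (simp add: r_def)
qed

section \<open>Eigenvalues of the enlarged matrix from those of \<open>L\<close>\<close>

lemma prod_linear_factors:
  fixes M :: "'a::idom multiset"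
  defines "p \<equiv> (\<Prod>a\<in>#M. [:- a, 1:])"
  shows degree_prod_linear_factors: "degree p = size M"
    and proots_prod_linear_factors: "proots p = M"
proof -
  have "p \<noteq> 0 \<and> degree p = size M \<and> proots p = M"
    unfolding p_def
  proof (induction M)
    case (add a M)
    have "[:- a, 1:] \<noteq> 0" by simp
    with add show ?case
      by (simp add: degree_mult_eq proots_mult del: mult_pCons_left)
  qed auto
  then show "degree p = size M" "proots p = M" by auto
qed

text \<open>For \<open>x\<close> other than 1 put \<open>y = x (x - k) / (x - 1)\<close>. The
  remaining determinant is then \<open>(x - 1) ^ N\<close> times the characteristic polynomial of
  \<open>L\<close> at \<open>y\<close>, and each root \<open>a\<close> contributes
  \<open>(x - 1) (y - a) = x (x - k) - (x - 1) a\<close>.\<close>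

lemma char_poly_attach_mat:
  fixes L :: "real mat"
  assumes L: "L \<in> carrier_mat N N" and k: "k \<ge> 2"
    and M: "char_poly L = (\<Prod>a\<in>#M. [:- a, 1:])"
  shows "char_poly (attach_mat k N L) =
         [:- real k, 1:] ^ ((k - 2) * N) * (\<Prod>a\<in>#M. [:a, - (real k + a), 1:])"
    (is "?p = ?q")
proof -
  have size: "size M = N"
    using degree_monic_char_poly[OF L] by (simp add: M degree_prod_linear_factors)
  have "poly ?p x = poly ?q x" if x: "x \<noteq> 1" for x
  proof -
    define y where "y = x * (x - real k) / (x - 1)"
    have y: "(x - 1) * y = x * (x - real k)" using x by (simp add: y_def)
    have "(x * (x - real k)) \<cdot>\<^sub>m 1\<^sub>m N - (x - 1) \<cdot>\<^sub>m L = (x - 1) \<cdot>\<^sub>m - char_matrix L y"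
      unfolding y[symmetric] using L
      by (intro eq_matI) (auto simp: char_matrix_def algebra_simps)
    then have "det ((x * (x - real k)) \<cdot>\<^sub>m 1\<^sub>m N - (x - 1) \<cdot>\<^sub>m L) =
               (x - 1) ^ N * poly (char_poly L) y"
      using L by (simp add: char_poly_matrix[OF L] char_matrix_def)
    \<comment> \<open>As \<open>M\<close> has exactly \<open>N\<close> elements, each factor
      \<open>y - a\<close> receives one factor \<open>x - 1\<close>, which clears the denominator of
      \<open>y\<close>.\<close>
    also have "\<dots> = (\<Prod>a\<in>#M. (x - 1) * (y - a))"
      unfolding size[symmetric] M
      by (simp add: prod_mset.distrib poly_prod_mset image_mset.compositionality comp_def)
    also have "\<dots> = poly (\<Prod>a\<in>#M. [:a, - (real k + a), 1:]) x"
      unfolding right_diff_distrib y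
      by (simp add: poly_prod_mset image_mset.compositionality comp_def algebra_simps)
    finally show ?thesis
      unfolding poly_char_poly_attach_mat[OF L k] by (simp add: poly_power)
  qed
  \<comment> \<open>Agreement off the single point 1 is agreement at infinitely many points, so the
    polynomials coincide.\<close>
  then have "- {1} \<subseteq> {x. poly (?p - ?q) x = 0}" by auto
  moreover have "infinite (- {1 :: real})"
    by (simp add: infinite_UNIV_char_0 finite_compl)
  ultimately have "infinite {x. poly (?p - ?q) x = 0}"
    using finite_subset by blast
  then have "?p - ?q = 0"
    using poly_roots_finite by blast
  then show ?thesis by simp
qed

text \<open>The discriminant equals \<open>(k - a)^2 + 4 a (k - 1)\<close>, hence is nonnegative.
  The larger root is visibly positive, and the other one follows because the product
  \<open>a\<close> is positive.\<close>

lemma positive_roots_quadratic: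
  fixes k a :: real
  assumes "k \<ge> 1" "a > 0"
  obtains r s where "r > 0" "s > 0" "r + s = k + a" "r * s = a"
proof -
  define d where "d = sqrt ((k + a)\<^sup>2 - 4 * a)"
  have disc: "(k + a)\<^sup>2 - 4 * a = (k - a)\<^sup>2 + 4 * (a * (k - 1))"
    by (simp add: power2_eq_square algebra_simps)
  have "d \<ge> 0" and d2: "d\<^sup>2 = (k + a)\<^sup>2 - 4 * a"
    using assms unfolding d_def disc by auto
  define r s where "r = (k + a + d) / 2" and "s = (k + a - d) / 2"
  have rs: "r + s = k + a" "r * s = a"
    using d2 by (auto simp: r_def s_def field_simps power2_eq_square)
  have "r > 0" using assms \<open>d \<ge> 0\<close> by (simp add: r_def)
  moreover from this have "s > 0" using rs(2) assms(2) zero_less_mult_pos by blast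
  ultimately show ?thesis using that rs by blast
qed

section \<open>Arcs, degrees and Laplacian after attaching cliques\<close>

text \<open>On an initial segment of the naturals \<open>vertex_list\<close> is the identity.
  Degrees are written as sums of indicators so that \<open>sum_div_mod\<close> can split them by
  block.\<close>

lemma laplacian_eq_mat:
  fixes G :: "nat pair_pre_digraph"
  assumes V: "pverts G = {..<N}" and E: "parcs G \<subseteq> {..<N} \<times> {..<N}"
  shows "laplacian G = mat N N (\<lambda>(i, j).
    of_bool (i = j) * (\<Sum>l<N. of_bool ((i, l) \<in> parcs G)) - of_bool ((i, j) \<in> parcs G))"
proof -
  have nth: "vertex_list G ! i = i" if "i < N" for i
    using that by (simp add: vertex_list_def V sorted_list_of_set_range lessThan_atLeast0)
  have deg: "real (out_degree (with_proj G) i) = (\<Sum>l<N. of_bool ((i, l) \<in> parcs G))" for i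
  proof -
    have "out_arcs (with_proj G) i = Pair i ` {l\<in>{..<N}. (i, l) \<in> parcs G}"
      using E by (auto simp: out_arcs_def)
    then have "out_degree (with_proj G) i = card {l\<in>{..<N}. (i, l) \<in> parcs G}"
      by (simp add: out_degree_def card_image inj_on_def)
    then show ?thesis by (simp add: sum_of_bool_eq Int_def)
  qed
  show ?thesis
    unfolding laplacian_def degree_matrix_def adjacency_matrix_def V
    by (intro eq_matI) (auto simp: nth deg)
qed

lemma mem_new_vertices_iff:
  assumes "v < N"
  shows "u \<in> new_vertices k N v \<longleftrightarrow> u mod N = v \<and> u div N \<noteq> 0 \<and> u < k * N"
proof
  assume "u \<in> new_vertices k N v"
  then obtain c where c: "u = v + c * N" "1 \<le> c" "c < k"
    by (auto simp: new_vertices_def)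
  have "u < Suc c * N" using c assms by simp
  also have "\<dots> \<le> k * N" using c by (intro mult_right_mono) auto
  finally show "u mod N = v \<and> u div N \<noteq> 0 \<and> u < k * N" using c assms by simp
next
  assume "u mod N = v \<and> u div N \<noteq> 0 \<and> u < k * N"
  moreover from this have "u = v + u div N * N" "u div N < k"
    by (auto simp: less_mult_imp_div_less)
  ultimately show "u \<in> new_vertices k N v"
    unfolding new_vertices_def by (intro CollectI exI[of _ "u div N"]) auto
qed

text \<open>A vertex \<open>v\<close> and its attached clique form the residue class of
  \<open>v\<close> modulo \<open>N\<close>, a complete graph on \<open>k\<close> vertices; old arcs
  stay in the layer with quotient 0.\<close>

lemma parcs_attach_cliques_iff:
  fixes G :: "nat pair_pre_digraph"
  assumes V: "pverts G = {..<N}" and E: "parcs G \<subseteq> {..<N} \<times> {..<N}"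
    and ij: "i < k * N" "j < k * N"
  shows "(i, j) \<in> parcs (attach_cliques k G) \<longleftrightarrow>
         i mod N = j mod N \<and> i div N \<noteq> j div N \<or> (i, j) \<in> parcs G"
proof -
  have "N > 0" using ij by (cases N) auto
  have old: "u = v \<longleftrightarrow> u mod N = v \<and> u div N = 0" if "v < N" for u v
    using that by (auto simp: div_eq_0_iff)
  have eq: "i = j \<longleftrightarrow> i mod N = j mod N \<and> i div N = j div N"
    by (metis div_mult_mod_eq)
  have "(i, j) \<in> parcs (attach_cliques k G) \<longleftrightarrow> (i, j) \<in> parcs G \<or>
      (\<exists>v<N. i \<in> new_vertices k N v \<and> j \<in> new_vertices k N v \<and> i \<noteq> j \<or>
            i = v \<and> j \<in> new_vertices k N v \<or> i \<in> new_vertices k N v \<and> j = v)"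
    by (auto simp: attach_cliques_def Let_def V complete_arcs_def)
  also have "\<dots> \<longleftrightarrow> (i, j) \<in> parcs G \<or> (\<exists>v<N. i mod N = v \<and> j mod N = v \<and> i div N \<noteq> j div N)"
    using ij old eq by (metis mem_new_vertices_iff)
  also have "\<dots> \<longleftrightarrow> i mod N = j mod N \<and> i div N \<noteq> j div N \<or> (i, j) \<in> parcs G"
    using \<open>N > 0\<close> by auto
  finally show ?thesis .
qed

lemma parcs_attach_cliques_subset:
  fixes G :: "nat pair_pre_digraph"
  assumes V: "pverts G = {..<N}" and E: "parcs G \<subseteq> {..<N} \<times> {..<N}" and k: "k \<ge> 1"
  shows "parcs (attach_cliques k G) \<subseteq> {..<k * N} \<times> {..<k * N}"
proof -
  have "N \<le> k * N" using k by simp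
  then have old: "v < k * N" if "v < N" for v using that by linarith
  have new: "u < k * N" if "v < N" "u \<in> new_vertices k N v" for u v
    using that by (simp add: mem_new_vertices_iff)
  show ?thesis using E old
    by (auto simp: attach_cliques_def Let_def V complete_arcs_def dest: new)
qed

text \<open>Each residue class modulo \<open>N\<close> is a complete graph with Laplacian
  \<open>k I - J\<close>, and the old graph adds its own Laplacian on block 0.\<close>

lemma laplacian_attach_cliques:
  fixes G :: "nat pair_pre_digraph"
  assumes V: "pverts G = {..<N}" and E: "parcs G \<subseteq> {..<N} \<times> {..<N}"
    and k: "k \<ge> 1" and N: "N \<ge> 1"
  shows "laplacian (attach_cliques k G) = attach_mat k N (laplacian G)"
proof (rule eq_matI)
  let ?G = "attach_cliques k G"
  note L = laplacian_eq_mat[OF V E]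
  note L' = laplacian_eq_mat[OF pverts_attach_cliques[OF V k N]
                                parcs_attach_cliques_subset[OF V E k]]
  show "dim_row (laplacian ?G) = dim_row (attach_mat k N (laplacian G))"
    "dim_col (laplacian ?G) = dim_col (attach_mat k N (laplacian G))"
    by (simp_all add: L' attach_mat_def)
  fix i j
  assume "i < dim_row (attach_mat k N (laplacian G))" "j < dim_col (attach_mat k N (laplacian G))"
  then have ij: "i < k * N" "j < k * N" by (simp_all add: attach_mat_def)
  define c v d w where "c = i div N" and "v = i mod N" and "d = j div N" and "w = j mod N"
  have lt: "c < k" "v < N" "d < k" "w < N"
    using ij N by (auto simp: c_def v_def d_def w_def less_mult_imp_div_less)
  have eq: "i = j \<longleftrightarrow> c = d \<and> v = w"
    unfolding c_def v_def d_def w_def by (metis div_mult_mod_eq)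
  \<comment> \<open>The indicators add up because the cases exclude each other: clique arcs join
    different quotients, old arcs have quotient 0 at both ends.\<close>
  have arc: "of_bool ((i, l) \<in> parcs ?G) = (of_bool (v = l mod N \<and> c \<noteq> l div N) +
               of_bool (c = 0 \<and> l div N = 0 \<and> (v, l mod N) \<in> parcs G) :: real)"
    if "l < k * N" for l
  proof -
    have "(i, l) \<in> parcs G \<longleftrightarrow> c = 0 \<and> l div N = 0 \<and> (v, l mod N) \<in> parcs G"
    proof (cases "i < N \<and> l < N")
      case True then show ?thesis by (simp add: c_def v_def)
    next
      case False
      then have "(i, l) \<notin> parcs G" using E by auto
      with False N show ?thesis by (auto simp: c_def div_eq_0_iff)
    qed
    then show ?thesis
      using parcs_attach_cliques_iff[OF V E ij(1) that] by (auto simp: c_def v_def)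
  qed
  have "(\<Sum>l<k * N. of_bool ((i, l) \<in> parcs ?G)) =
        (\<Sum>l<k * N. of_bool (v = l mod N \<and> c \<noteq> l div N) +
               of_bool (c = 0 \<and> l div N = 0 \<and> (v, l mod N) \<in> parcs G) :: real)"
    using arc by simp
  also have "\<dots> = (\<Sum>e<k. \<Sum>u<N. of_bool (v = u \<and> c \<noteq> e) +
                                 of_bool (c = 0 \<and> e = 0 \<and> (v, u) \<in> parcs G))"
    by (rule sum_div_mod)
  also have "\<dots> = (\<Sum>e<k. (1 - (if e = c then 1 else 0)) +
      (if e = 0 then of_bool (c = 0) * (\<Sum>u<N. of_bool ((v, u) \<in> parcs G)) else 0))"
  proof (rule sum.cong)
    fix e
    have "(\<Sum>u<N. of_bool (v = u \<and> c \<noteq> e) :: real) = (\<Sum>u<N. if u = v then of_bool (c \<noteq> e) else 0)"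
      by (rule sum.cong) auto
    then show "(\<Sum>u<N. of_bool (v = u \<and> c \<noteq> e) + of_bool (c = 0 \<and> e = 0 \<and> (v, u) \<in> parcs G)) =
      (1 - (if e = c then 1 else 0)) +
      (if e = 0 then of_bool (c = 0) * (\<Sum>u<N. of_bool ((v, u) \<in> parcs G)) else (0::real))"
      using lt by (auto simp: sum.distrib)
  qed simp
  \<comment> \<open>Every vertex has \<open>k - 1\<close> neighbours in its residue class; those of
    layer 0 also keep their old ones.\<close>
  also have "\<dots> = real k - 1 + of_bool (c = 0) * (\<Sum>u<N. of_bool ((v, u) \<in> parcs G))"
    using lt k unfolding sum.distrib sum_subtractf by simp
  finally have deg: "(\<Sum>l<k * N. of_bool ((i, l) \<in> parcs ?G)) =
      real k - 1 + of_bool (c = 0) * (\<Sum>u<N. of_bool ((v, u) \<in> parcs G))" .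
  have "laplacian ?G $$ (i, j) =
        of_bool (c = d \<and> v = w) *
          (real k - 1 + of_bool (c = 0) * (\<Sum>u<N. of_bool ((v, u) \<in> parcs G)))
        - (of_bool (v = w \<and> c \<noteq> d) + of_bool (c = 0 \<and> d = 0 \<and> (v, w) \<in> parcs G))"
    using ij by (simp only: L' index_mat(1) prod.case deg arc eq d_def w_def)
  also have "\<dots> = attach_mat k N (laplacian G) $$ (i, j)"
    using ij lt by (auto simp: attach_mat_def L simp flip: c_def v_def d_def w_def)
  finally show "laplacian ?G $$ (i, j) = attach_mat k N (laplacian G) $$ (i, j)" .
qed


section \<open>Coherence of hierarchical graphs\<close>

text \<open>Since all of \<open>M\<close> is positive, 0 heads the sorted list, and starting the sum
  at index 1 omits exactly this entry. What is left does not depend on the order.\<close>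

lemma network_coherence1_eq:
  fixes G :: "'a::linorder pair_pre_digraph"
  assumes M: "char_poly (laplacian G) = [:0, 1:] * (\<Prod>a\<in>#M. [:- a, 1:])"
    and pos: "\<And>a. a \<in># M \<Longrightarrow> a > 0"
    and card: "card (pverts G) = Suc (size M)"
  shows "network_coherence1 G = 1 / (2 * real (card (pverts G))) * (\<Sum>a\<in>#M. 1 / a)"
proof -
  define l where "l = sorted_list_of_multiset M"
  have mset_l: "mset l = M" by (simp add: l_def)
  have "proots (char_poly (laplacian G)) = add_mset 0 M"
    using proots_prod_linear_factors[of "add_mset 0 M"] by (simp add: M)
  then have "laplacian_eigenvalues G = insort 0 l"
    by (simp add: laplacian_eigenvalues_def l_def)
  also have "\<dots> = 0 # l"
    using pos by (intro insort_is_Cons) (auto simp: l_def less_imp_le)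
  finally have ev: "laplacian_eigenvalues G = 0 # l" .
  have "length l = size M" by (simp flip: mset_l)
  have "(\<Sum>i = 1..<card (pverts G). 1 / (laplacian_eigenvalues G ! i)) =
        (\<Sum>i = 0..<size M. 1 / (l ! i))"
    unfolding card ev One_nat_def sum.shift_bounds_Suc_ivl by simp
  also have "\<dots> = sum_list (map (\<lambda>a. 1 / a) l)"
    using \<open>length l = size M\<close> by (simp add: sum_list_sum_nth)
  also have "\<dots> = (\<Sum>a\<in>#M. 1 / a)"
    using mset_l by (metis mset_map sum_mset_sum_list)
  finally show ?thesis by (simp add: network_coherence1_def)
qed

text \<open>Attaching a clique to the single vertex 0 gives the complete graph, so the exponent
  \<open>n - 1\<close> becomes \<open>n\<close> and inductions can start at 0.\<close>

lemma hierarchical_graph_eq_funpow: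
  assumes "n \<ge> 1" "k \<ge> 1"
  shows "hierarchical_graph n k = (attach_cliques k ^^ n) \<lparr>pverts = {0}, parcs = {}\<rparr>"
proof -
  have new: "new_vertices k (Suc 0) 0 = {1..<k}"
    by (auto simp: new_vertices_def)
  have "attach_cliques k \<lparr>pverts = {0}, parcs = {}\<rparr> = complete_graph k"
    using assms(2)
    by (auto simp: attach_cliques_def complete_graph_def complete_arcs_def Let_def new
        simp del: One_nat_def)
  then show ?thesis
    using assms(1) by (cases n) (simp_all add: hierarchical_graph_def funpow_swap1)
qed

text \<open>\<open>M\<close> collects the nonzero eigenvalues. With \<open>N = k ^ n\<close>, their
  reciprocal sum \<open>S\<close> becomes \<open>((k - 2) N + 1) / k + (N - 1) + k S\<close> in the
  next graph, which the closed form satisfies. Writing \<open>real k ^ n / real k\<close> avoids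
  truncated subtraction in the exponent.\<close>

lemma hierarchical_spectrum:
  fixes k n :: nat
  assumes k: "k \<ge> 2"
  defines "G \<equiv> (attach_cliques k ^^ n) \<lparr>pverts = {0}, parcs = {}\<rparr>"
  shows "pverts G = {..<k ^ n} \<and> parcs G \<subseteq> {..<k ^ n} \<times> {..<k ^ n} \<and>
    (\<exists>M. char_poly (laplacian G) = [:0, 1:] * (\<Prod>a\<in>#M. [:- a, 1:]) \<and>
         (\<forall>a\<in>#M. a > 0) \<and> k ^ n = Suc (size M) \<and>
         real k * (\<Sum>a\<in>#M. 1 / a) =
           (2 * real n - 1) * real k ^ n - 2 * real n * (real k ^ n / real k) + 1)"
  unfolding G_def
proof (induction n)
  case 0
  have "laplacian \<lparr>pverts = {0::nat}, parcs = {}\<rparr> = 0\<^sub>m 1 1"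
    by (subst laplacian_eq_mat[of _ 1]) auto
  then have "char_poly (laplacian \<lparr>pverts = {0::nat}, parcs = {}\<rparr>) = [:0, 1:]"
    by (simp add: char_poly_def char_poly_matrix_def det_single)
  then show ?case by (auto intro!: exI[of _ "{#}"])
next
  case (Suc n)
  define G where "G = (attach_cliques k ^^ n) \<lparr>pverts = {0::nat}, parcs = {}\<rparr>"
  define N where "N = k ^ n"
  have N: "N \<ge> 1" using k by (simp add: N_def)
  have k1: "k \<ge> 1" using k by simp
  have Nk: "real k ^ n = real N" by (simp add: N_def)
  from Suc.IH obtain M where V: "pverts G = {..<N}" and E: "parcs G \<subseteq> {..<N} \<times> {..<N}"
    and M: "char_poly (laplacian G) = [:0, 1:] * (\<Prod>a\<in>#M. [:- a, 1:])"
    and pos: "\<forall>a\<in>#M. a > 0" and size: "N = Suc (size M)"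
    and S: "real k * (\<Sum>a\<in>#M. 1 / a) =
           (2 * real n - 1) * real N - 2 * real n * (real N / real k) + 1"
    unfolding G_def[symmetric] N_def[symmetric] Nk by (elim conjE exE) blast
  have L: "laplacian G \<in> carrier_mat N N"
    by (simp add: laplacian_eq_mat[OF V E])
  have "\<exists>r s. r > 0 \<and> s > 0 \<and> r + s = real k + a \<and> r * s = a" if "a > 0" for a
    by (rule positive_roots_quadratic[of "real k" a]) (use that k1 in \<open>simp, simp, blast\<close>)
  then obtain r s where rs: "r a > 0" "s a > 0" "r a + s a = real k + a" "r a * s a = a"
    if "a > 0" for a by metis
  \<comment> \<open>The single \<open>k\<close> is the partner of 0 among the roots for the
    eigenvalue 0; the \<open>(k - 2) * N\<close> copies come from the scalar block;
    \<open>r a\<close> and \<open>s a\<close> replace each positive eigenvalue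
    \<open>a\<close>.\<close>
  define M' where "M' = add_mset (real k) (replicate_mset ((k - 2) * N) (real k))
                        + (image_mset r M + image_mset s M)"
  have "char_poly (laplacian (attach_cliques k G)) =
        [:- real k, 1:] ^ ((k - 2) * N) * ([:0, - real k, 1:] *
          (\<Prod>a\<in>#M. [:a, - (real k + a), 1:]))"
    unfolding laplacian_attach_cliques[OF V E k1 N]
    using char_poly_attach_mat[OF L k, of "add_mset 0 M"] M by simp
  also have "(\<Prod>a\<in>#M. [:a, - (real k + a), 1:]) = (\<Prod>a\<in>#M. [:- r a, 1:] * [:- s a, 1:])"
  proof (rule arg_cong[of _ _ prod_mset], rule image_mset_cong)
    fix a assume "a \<in># M"
    then have "a > 0" using pos by simp
    from rs(3,4)[OF this] show "[:a, - (real k + a), 1:] = [:- r a, 1:] * [:- s a, 1:]"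
      by (simp add: mult.commute)
  qed
  also have "[:- real k, 1:] ^ ((k - 2) * N) * ([:0, - real k, 1:] *
        (\<Prod>a\<in>#M. [:- r a, 1:] * [:- s a, 1:])) = [:0, 1:] * (\<Prod>a\<in>#M'. [:- a, 1:])"
  proof -
    have "[:0, - real k, 1:] = [:0, 1:] * [:- real k, 1:]" by simp
    then show ?thesis
      by (simp only: M'_def image_mset_union prod_mset.union image_mset_add_mset
          prod_mset.add_mset image_replicate_mset prod_mset_replicate_mset prod_mset.distrib
          image_mset.compositionality comp_def mult_ac)
  qed
  finally have char: "char_poly (laplacian (attach_cliques k G)) =
    [:0, 1:] * (\<Prod>a\<in>#M'. [:- a, 1:])" .
  have "Suc (size M') = 2 + 2 * size M + (k - 2) * N"
    by (simp add: M'_def)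
  also have "\<dots> = 2 * N + (k - 2) * N" by (simp add: size)
  also have "\<dots> = k * N" using k by (metis add_mult_distrib le_add_diff_inverse)
  finally have size': "k ^ Suc n = Suc (size M')" by (simp add: N_def)
  have pos': "\<forall>a\<in>#M'. a > 0"
    using pos rs k by (auto simp: M'_def in_replicate_mset)
  have "(\<Sum>a\<in>#M'. 1 / a) = (real ((k - 2) * N) + 1) / real k +
        (\<Sum>a\<in>#M. 1 / r a + 1 / s a)"
    by (simp add: M'_def sum_mset.distrib image_mset.compositionality comp_def add_divide_distrib)
  also have "(\<Sum>a\<in>#M. 1 / r a + 1 / s a) = (\<Sum>a\<in>#M. 1 + real k * (1 / a))"
  proof (rule arg_cong[of _ _ sum_mset], rule image_mset_cong)
    fix a assume "a \<in># M"
    then have a: "a > 0" using pos by simp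
    have "1 / r a + 1 / s a = (r a + s a) / (r a * s a)"
      using rs(1,2)[OF a] by (simp add: field_simps)
    also have "\<dots> = 1 + real k * (1 / a)"
      using a by (simp add: rs(3,4) field_simps)
    finally show "1 / r a + 1 / s a = 1 + real k * (1 / a)" .
  qed
  also have "\<dots> = real (size M) + real k * (\<Sum>a\<in>#M. 1 / a)"
    by (simp add: sum_mset.distrib sum_mset_distrib_left image_mset.compositionality comp_def)
  also have "real (size M) = real N - 1" using size by simp
  finally have sum': "(\<Sum>a\<in>#M'. 1 / a) = (real ((k - 2) * N) + 1) / real k +
      (real N - 1 + real k * (\<Sum>a\<in>#M. 1 / a))" .
  have "real k * (\<Sum>a\<in>#M'. 1 / a) =
      (real k - 2) * real N + 1 + real k * (real N - 1) +
      real k * ((2 * real n - 1) * real N - 2 * real n * (real N / real k) + 1)"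
    unfolding sum' S using k by (simp add: of_nat_diff field_simps)
  also have "\<dots> = (2 * real (Suc n) - 1) * real k ^ Suc n
                  - 2 * real (Suc n) * (real k ^ Suc n / real k) + 1"
    using k by (simp add: N_def algebra_simps)
  finally have S': "real k * (\<Sum>a\<in>#M'. 1 / a) = (2 * real (Suc n) - 1) * real k ^ Suc n
                  - 2 * real (Suc n) * (real k ^ Suc n / real k) + 1" .
  have "pverts (attach_cliques k G) = {..<k ^ Suc n}"
    "parcs (attach_cliques k G) \<subseteq> {..<k ^ Suc n} \<times> {..<k ^ Suc n}"
    using pverts_attach_cliques[OF V k1 N] parcs_attach_cliques_subset[OF V E k1]
    by (simp_all add: N_def)
  then show ?case
    unfolding funpow.simps(2) o_apply G_def[symmetric]
    by (intro conjI exI[of _ M'] char pos' size' S')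
qed

section \<open>The exact coherence and its growth\<close>

lemma network_coherence1_hierarchical_graph:
  assumes "k \<ge> 2" "n \<ge> 1"
  shows "network_coherence1 (hierarchical_graph n k) =
              ((2 * real n - 1) * real k ^ n - 2 * real n * real k ^ (n - 1) + 1)
                / (2 * real k ^ (n + 1))"
proof -
  have G: "hierarchical_graph n k = (attach_cliques k ^^ n) \<lparr>pverts = {0}, parcs = {}\<rparr>"
    using assms by (intro hierarchical_graph_eq_funpow) auto
  obtain M where V: "pverts (hierarchical_graph n k) = {..<k ^ n}"
    and M: "char_poly (laplacian (hierarchical_graph n k)) = [:0, 1:] * (\<Prod>a\<in>#M. [:- a, 1:])"
      "\<forall>a\<in>#M. a > 0" "k ^ n = Suc (size M)"
    and S: "real k * (\<Sum>a\<in>#M. 1 / a) =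
           (2 * real n - 1) * real k ^ n - 2 * real n * (real k ^ n / real k) + 1"
    using hierarchical_spectrum[OF assms(1), of n] unfolding G by (elim conjE exE) blast
  have "real k ^ n / real k = real k ^ (n - 1)"
    using assms by (cases n) auto
  with S have "(\<Sum>a\<in>#M. 1 / a) =
      ((2 * real n - 1) * real k ^ n - 2 * real n * real k ^ (n - 1) + 1) / real k"
    using assms by (simp add: field_simps)
  then show ?thesis
    using network_coherence1_eq[OF M(1)] M(2,3) V by (simp del: of_nat_Suc flip: of_nat_power)
qed

theorem mainTheorem2:
  fixes k :: nat
  assumes "k \<ge> 3"
  shows "(\<forall>n\<ge>1.
            card (pverts (hierarchical_graph n k)) = k ^ n \<and>
            network_coherence1 (hierarchical_graph n k) =
              ((2 * real n - 1) * real k ^ n - 2 * real n * real k ^ (n - 1) + 1)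
                / (2 * real k ^ (n + 1))) \<and>
         (\<lambda>n. network_coherence1 (hierarchical_graph n k) /
              ((real k - 1) / (real k)\<^sup>2 *
                 log (real k) (real (card (pverts (hierarchical_graph n k))))))
           \<longlonglongrightarrow> 1"
proof
  have card: "card (pverts (hierarchical_graph n k)) = k ^ n" if "n \<ge> 1" for n
    using pverts_hierarchical_graph[of k n] that assms by simp
  have H: "network_coherence1 (hierarchical_graph n k) =
      ((2 * real n - 1) * real k ^ n - 2 * real n * real k ^ (n - 1) + 1)
                / (2 * real k ^ (n + 1))" if "n \<ge> 1" for n
    using network_coherence1_hierarchical_graph[of k n] that assms by simp
  show "\<forall>n\<ge>1. card (pverts (hierarchical_graph n k)) = k ^ n \<and>
            network_coherence1 (hierarchical_graph n k) =
              ((2 * real n - 1) * real k ^ n - 2 * real n * real k ^ (n - 1) + 1)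
                / (2 * real k ^ (n + 1))"
    using card H by simp
  \<comment> \<open>The numerator is \<open>2 n (k - 1) k^(n-1) - (k^n - 1)\<close>. Dividing by the
    claimed asymptotics \<open>(k - 1) n / k^2\<close> leaves exactly
    \<open>1 - (C / n) (1 - k^(-n))\<close> for this \<open>C\<close>.\<close>
  define C where "C = real k / (2 * (real k - 1))"
  have "(\<lambda>n. 1 - C * inverse (real n) * (1 - inverse (real k) ^ n)) \<longlonglongrightarrow> 1 - C * 0 * (1 - 0)"
    using assms
    by (intro tendsto_intros LIMSEQ_inverse_real_of_nat lim_inverse_n LIMSEQ_realpow_zero)
       (auto simp: field_simps)
  moreover have "1 - C * inverse (real n) * (1 - inverse (real k) ^ n) =
      network_coherence1 (hierarchical_graph n k) / ((real k - 1) / (real k)\<^sup>2 *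
                 log (real k) (real (card (pverts (hierarchical_graph n k)))))"
    if n: "n \<ge> 1" for n
  proof -
    have "log (real k) (real k ^ n) = real n"
      using assms by (simp add: log_nat_power)
    moreover obtain m where "n = Suc m" using n by (cases n) auto
    moreover have "real k - 1 \<noteq> 0" "real k \<noteq> 0" using assms by auto
    ultimately show ?thesis
      unfolding H[OF n] card[OF n] C_def
      by (simp add: divide_simps power2_eq_square power_inverse) (simp add: algebra_simps)
  qed
  \<comment> \<open>The identity is available only for \<open>n >= 1\<close>, so the limit is
    transferred along eventual equality.\<close>
  ultimately show "(\<lambda>n. network_coherence1 (hierarchical_graph n k) /
              ((real k - 1) / (real k)\<^sup>2 *
                 log (real k) (real (card (pverts (hierarchical_graph n k))))))
           \<longlonglongrightarrow> 1"
    by (auto intro!: Lim_transform_eventually[where f = "\<lambda>n. 1 - C * inverse (real n) *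
          (1 - inverse (real k) ^ n)"] eventually_sequentiallyI[of 1])
qed

end
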